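(* Let $f, g_1,\ldots,g_m:\mathbb{R}^n\to\mathbb{R}$ be differentiable functions, let $\mathbf{K}:=\{\mathbf{x}\in\mathbb{R}^n : g_j(\mathbf{x})\leq 0,\ j=1,\ldots,m\}$, and assume that $\mathbf{K}$ is convex (the functions $g_j$ are not assumed to be convex). Consider the problem $f^*:=\inf_{\mathbf{x}}\{f(\mathbf{x}) : \mathbf{x}\in\mathbf{K}\}$. Assume that: (i) (nondegeneracy) for every $j=1,\ldots,m$, $\nabla g_j(\mathbf{x})\neq 0$ whenever $\mathbf{x}\in\mathbf{K}$ and $g_j(\mathbf{x})=0$; (ii) (Slater's condition) there exists $\mathbf{x}_0\in\mathbf{K}$ such that $g_j(\mathbf{x}_0)<0$ for every $j=1,\ldots,m$. If $f$ is convex, then every minimizer of $f$ on $\mathbf{K}$ is a KKT point and, conversely, every KKT point is a minimizer of $f$ on $\mathbf{K}$.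
   Context: A point $\mathbf{x}\in\mathbf{K}$ is a minimizer if $f(\mathbf{x})=f^*$, i.e. $f(\mathbf{x})\leq f(\mathbf{y})$ for all $\mathbf{y}\in\mathbf{K}$. A point $\mathbf{x}\in\mathbf{K}$ is a KKT (Karush-Kuhn-Tucker) point if there exists a vector $\lambda\in\mathbb{R}^m$ with $\lambda_j\geq 0$ for all $j$ such that $\nabla f(\mathbf{x})+\sum_{j=1}^m\lambda_j\nabla g_j(\mathbf{x})=0$ and $\lambda_j\,g_j(\mathbf{x})=0$ for $j=1,\ldots,m$. *)

theory Defs
  imports "HOL-Analysis.Analysis"
begin

text \<open>The gradient as a function, based on the library predicate \<open>GDERIV f x :> D\<close>.
  It is only meaningful where \<open>f\<close> is differentiable, see \<open>GDERIV_gradient\<close>.\<close>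

definition gradient :: "('a::euclidean_space \<Rightarrow> real) \<Rightarrow> 'a \<Rightarrow> 'a" where
  "gradient f x = (THE D. GDERIV f x :> D)"

lemma gradient_eqI:
  assumes "GDERIV f x :> D"
  shows "gradient f x = D"
  unfolding gradient_def
proof (rule the_equality)
  show "GDERIV f x :> D" by (rule assms)
next
  fix E assume "GDERIV f x :> E"
  then have "(\<lambda>h. inner h E) = (\<lambda>h. inner h D)"
    using assms unfolding gderiv_def by (rule has_derivative_unique)
  then have "inner h E = inner h D" for h by (rule fun_cong)
  then show "E = D" by (metis inner_commute vector_eq_rdot)
qed

lemma GDERIV_gradient:
  fixes f :: "'a::euclidean_space \<Rightarrow> real"
  assumes "f differentiable (at x)"
  shows "GDERIV f x :> gradient f x"
proof -
  obtain F where F: "(f has_derivative F) (at x)"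
    using assms by (auto simp: differentiable_def)
  then have "linear F" by (rule has_derivative_linear)
  then have "F = (\<lambda>h. inner h (adjoint F 1))"
    by (simp add: fun_eq_iff adjoint_works)
  with F have "GDERIV f x :> adjoint F 1" by (simp add: gderiv_def)
  then show ?thesis using gradient_eqI by metis
qed

text \<open>The constraints are \<open>g 1, \<dots>, g m\<close>; the values of \<open>g\<close>, and of the multipliers \<open>l\<close>
  below, at indices outside \<open>{1..m}\<close> play no role.\<close>

definition feasible_set :: "nat \<Rightarrow> (nat \<Rightarrow> 'a \<Rightarrow> real) \<Rightarrow> 'a set" where
  "feasible_set m g = {x. \<forall>j\<in>{1..m}. g j x \<le> 0}"

definition minimizer_on :: "('a \<Rightarrow> real) \<Rightarrow> 'a set \<Rightarrow> 'a \<Rightarrow> bool" where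
  "minimizer_on f K x \<longleftrightarrow> x \<in> K \<and> (\<forall>y\<in>K. f x \<le> f y)"

text \<open>The optimal value is taken in the extended reals, as \<open>f\<close> may be unbounded below
  on \<open>K\<close>.\<close>

lemma minimizer_on_iff_INF:
  "minimizer_on f K x \<longleftrightarrow> x \<in> K \<and> ereal (f x) = (INF y\<in>K. ereal (f y))"
proof
  assume "minimizer_on f K x"
  then show "x \<in> K \<and> ereal (f x) = (INF y\<in>K. ereal (f y))"
    by (auto simp: minimizer_on_def intro!: antisym INF_greatest INF_lower)
next
  assume "x \<in> K \<and> ereal (f x) = (INF y\<in>K. ereal (f y))"
  then show "minimizer_on f K x"
    unfolding minimizer_on_def by (metis INF_lower ereal_less_eq(3))
qed

definition KKT_point ::
  "('a::euclidean_space \<Rightarrow> real) \<Rightarrow> nat \<Rightarrow> (nat \<Rightarrow> 'a \<Rightarrow> real) \<Rightarrow> 'a \<Rightarrow> bool" where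
  "KKT_point f m g x \<longleftrightarrow> x \<in> feasible_set m g \<and>
     (\<exists>l :: nat \<Rightarrow> real.
        (\<forall>j\<in>{1..m}. 0 \<le> l j) \<and>
        gradient f x + (\<Sum>j\<in>{1..m}. l j *\<^sub>R gradient (g j) x) = 0 \<and>
        (\<forall>j\<in>{1..m}. l j * g j x = 0))"

end

theory Submission
  imports Defs
begin

text \<open>Since \<open>K\<close> is convex, every constraint \<open>g j\<close> active at \<open>x \<in> K\<close> has
  \<open>\<nabla>g j(x) \<bullet> (y - x) \<le> 0\<close> for all \<open>y \<in> K\<close>; with the gradient inequality for \<open>f\<close>
  this makes KKT points minimizers. For the converse, a minimizer admits no direction that
  strictly decreases \<open>f\<close> and all active constraints to first order, so by separation \<open>0\<close> is a
  convex combination of \<open>\<nabla>f(x)\<close> and the active \<open>\<nabla>g j(x)\<close>. The coefficient of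
  \<open>\<nabla>f(x)\<close> cannot vanish: the Slater point \<open>x0\<close> is interior to \<open>K\<close>, so nondegeneracy
  sharpens the inequality to \<open>\<nabla>g j(x) \<bullet> (x0 - x) < 0\<close>.\<close>

section \<open>First-order behaviour along rays and lines\<close>

lemma has_real_derivative_along_line:
  assumes "GDERIV f x :> D"
  shows "((\<lambda>t. f (x + t *\<^sub>R u)) has_real_derivative (u \<bullet> D)) (at 0)"
proof -
  have "((\<lambda>t::real. x + t *\<^sub>R u) has_derivative (\<lambda>t. t *\<^sub>R u)) (at 0)"
    by (auto intro!: derivative_eq_intros)
  moreover have "(f has_derivative (\<lambda>h. h \<bullet> D)) (at (x + 0 *\<^sub>R u))"
    using assms by (simp add: gderiv_def)
  ultimately have "((\<lambda>t. f (x + t *\<^sub>R u)) has_derivative (\<lambda>t. (t *\<^sub>R u) \<bullet> D)) (at 0)"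
    by (rule has_derivative_compose)
  then show ?thesis
    by (simp add: has_field_derivative_def mult_commute_abs)
qed

lemma eventually_less_along_line:
  assumes "GDERIV f x :> D" and "u \<bullet> D < 0"
  shows "eventually (\<lambda>t. f (x + t *\<^sub>R u) < f x) (at_right 0)"
proof -
  obtain d where "d > 0" "\<And>h. 0 < h \<Longrightarrow> h < d \<Longrightarrow> f (x + h *\<^sub>R u) < f x"
    using DERIV_neg_dec_right[OF has_real_derivative_along_line[OF assms(1)] assms(2)] by auto
  then show ?thesis
    by (auto simp: eventually_at_right_field)
qed

lemma eventually_greater_along_line:
  assumes "GDERIV f x :> D" and "u \<bullet> D > 0"
  shows "eventually (\<lambda>t. f (x + t *\<^sub>R u) > f x) (at_right 0)"
  using eventually_less_along_line[OF GDERIV_minus[OF assms(1)], of u] assms(2) by simp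

lemma eventually_neg_along_line:
  fixes f :: "'a::real_normed_vector \<Rightarrow> real"
  assumes "isCont f x" and "f x < 0"
  shows "eventually (\<lambda>t. f (x + t *\<^sub>R u) < 0) (at_right 0)"
proof -
  have "((\<lambda>t::real. x + t *\<^sub>R u) \<longlongrightarrow> x + 0 *\<^sub>R u) (at_right 0)"
    by (intro tendsto_intros)
  then have "((\<lambda>t::real. f (x + t *\<^sub>R u)) \<longlongrightarrow> f x) (at_right 0)"
    using isCont_tendsto_compose[OF assms(1)] by simp
  then show ?thesis
    using assms(2) by (rule order_tendstoD(2))
qed

text \<open>Restricting \<open>f\<close> to the line through \<open>x\<close> and \<open>y\<close>
  reduces this to the tangent inequality for a convex function of one real variable, between the
  parameters 0 and 1.\<close>

lemma convex_on_above_gradient: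
  assumes "convex_on UNIV f" and "GDERIV f x :> D"
  shows "f x + (y - x) \<bullet> D \<le> f y"
proof -
  let ?h = "\<lambda>t::real. f (x + t *\<^sub>R (y - x))"
  have "convex_on UNIV ?h"
  proof (rule convex_onI)
    fix t a b :: real
    assume t: "0 < t" "t < 1"
    have "x + ((1 - t) *\<^sub>R a + t *\<^sub>R b) *\<^sub>R (y - x)
        = (1 - t) *\<^sub>R (x + a *\<^sub>R (y - x)) + t *\<^sub>R (x + b *\<^sub>R (y - x))"
      by (simp add: algebra_simps)
    then show "?h ((1 - t) *\<^sub>R a + t *\<^sub>R b) \<le> (1 - t) * ?h a + t * ?h b"
      using convex_onD[OF assms(1), of t] t by simp
  qed simp
  then have "?h 1 - ?h 0 \<ge> ((y - x) \<bullet> D) * (1 - 0)"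
    by (rule convex_on_imp_above_tangent)
      (use has_real_derivative_along_line[OF assms(2)] in auto)
  then show ?thesis by simp
qed

section \<open>Convex hulls and a theorem of the alternative\<close>

text \<open>The coefficients are indexed by \<open>I\<close> and not by points of the image, so
  \<open>a\<close> may fail to be injective: constraints that share a gradient at a point still
  carry separate multipliers.\<close>

lemma convex_hull_finite_image:
  assumes "finite I"
  shows "convex hull (a ` I) =
    {\<Sum>i\<in>I. c i *\<^sub>R a i |c. (\<forall>i\<in>I. 0 \<le> c i) \<and> sum c I = (1::real)}" (is "_ = ?S")
proof
  show "convex hull (a ` I) \<subseteq> ?S"
  proof (rule hull_minimal)
    show "a ` I \<subseteq> ?S"
    proof
      fix v assume "v \<in> a ` I"
      then obtain i where i: "i \<in> I" "v = a i" by auto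
      have "(\<Sum>k\<in>I. (if k = i then 1 else 0) *\<^sub>R a k) = v"
        using i assms by (simp add: if_distrib[of "\<lambda>r. r *\<^sub>R _"] cong: if_cong)
      then show "v \<in> ?S"
        using i assms by (intro CollectI exI[of _ "\<lambda>k. if k = i then 1 else 0"]) auto
    qed
    show "convex ?S"
    proof (rule convexI)
      fix v w and s t :: real
      assume st: "0 \<le> s" "0 \<le> t" "s + t = 1" and "v \<in> ?S" "w \<in> ?S"
      then obtain c d where
        c: "v = (\<Sum>i\<in>I. c i *\<^sub>R a i)" "\<forall>i\<in>I. 0 \<le> c i" "sum c I = 1" and
        d: "w = (\<Sum>i\<in>I. d i *\<^sub>R a i)" "\<forall>i\<in>I. 0 \<le> d i" "sum d I = 1"
        by auto
      have "s *\<^sub>R v + t *\<^sub>R w = (\<Sum>i\<in>I. (s * c i + t * d i) *\<^sub>R a i)"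
        by (simp add: c d scaleR_sum_right sum.distrib scaleR_add_left)
      moreover have "(\<Sum>i\<in>I. s * c i + t * d i) = 1"
        using c d st by (simp add: sum.distrib flip: sum_distrib_left)
      ultimately show "s *\<^sub>R v + t *\<^sub>R w \<in> ?S"
        using c d st by (intro CollectI exI[of _ "\<lambda>i. s * c i + t * d i"]) auto
    qed
  qed
  show "?S \<subseteq> convex hull (a ` I)"
    using assms by (auto intro!: convex_sum[OF _ convex_convex_hull] intro: hull_inc)
qed

text \<open>One direction of Gordan's theorem. If 0 lay outside the hull of the vectors
  \<open>a i\<close>, which is compact, a hyperplane would separate the two strictly, and its
  negated normal would be an excluded direction \<open>u\<close>.\<close>

lemma gordan_alternative:
  fixes a :: "'i \<Rightarrow> 'a::euclidean_space"
  assumes "finite I" and "\<nexists>u. \<forall>i\<in>I. u \<bullet> a i < 0"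
  obtains c :: "'i \<Rightarrow> real" where
    "\<forall>i\<in>I. 0 \<le> c i" "sum c I = 1" "(\<Sum>i\<in>I. c i *\<^sub>R a i) = 0"
proof -
  have "0 \<in> convex hull (a ` I)"
  proof (rule ccontr)
    assume "0 \<notin> convex hull (a ` I)"
    moreover have "closed (convex hull (a ` I))"
      using assms(1) by (simp add: compact_imp_closed finite_imp_compact_convex_hull)
    ultimately obtain u b where "0 < b" "\<forall>v\<in>convex hull (a ` I). u \<bullet> v > b"
      using separating_hyperplane_closed_0[OF convex_convex_hull] by metis
    then have "\<forall>i\<in>I. (- u) \<bullet> a i < 0"
      by (force intro: hull_inc)
    with assms(2) show False by blast
  qed
  then show ?thesis
    using that by (auto simp: convex_hull_finite_image[OF assms(1)])
qed

section \<open>Constraint gradients and descent directions\<close>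

text \<open>Otherwise \<open>g j\<close> would turn positive just after leaving \<open>x\<close>
  towards \<open>y\<close>, although the segment between them is feasible. Here convexity of the
  feasible set stands in for convexity of \<open>g j\<close>.\<close>

lemma active_gradient_nonpos:
  assumes "convex (feasible_set m g)" and "x \<in> feasible_set m g" "y \<in> feasible_set m g"
    and "j \<in> {1..m}" "g j x = 0" and D: "GDERIV (g j) x :> D"
  shows "(y - x) \<bullet> D \<le> 0"
proof (rule ccontr)
  assume "\<not> ?thesis"
  then have "eventually (\<lambda>t. g j (x + t *\<^sub>R (y - x)) > g j x) (at_right 0)"
    by (intro eventually_greater_along_line[OF D]) simp
  moreover have "eventually (\<lambda>t::real. 0 < t \<and> t < 1) (at_right 0)"
    by (auto simp: eventually_at_right_field intro!: exI[of _ 1])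
  ultimately have "eventually (\<lambda>t. 0 < t \<and> t < 1 \<and> g j (x + t *\<^sub>R (y - x)) > 0) (at_right (0::real))"
    by eventually_elim (use assms(5) in auto)
  then obtain t :: real where t: "0 < t" "t < 1" "g j (x + t *\<^sub>R (y - x)) > 0"
    using eventually_happens'[OF trivial_limit_at_right_real] by blast
  have "(1 - t) *\<^sub>R x + t *\<^sub>R y \<in> feasible_set m g"
    using assms(1-3) t by (intro convexD_alt) auto
  moreover have "(1 - t) *\<^sub>R x + t *\<^sub>R y = x + t *\<^sub>R (y - x)"
    by (simp add: algebra_simps)
  ultimately have "g j (x + t *\<^sub>R (y - x)) \<le> 0"
    using assms(4) by (simp add: feasible_set_def)
  with t show False by simp
qed

text \<open>A small step from \<open>x0\<close> in direction \<open>D\<close> stays feasible, which gains \<open>D \<bullet> D > 0\<close>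
  in the inequality \<open>active_gradient_nonpos\<close>.\<close>

lemma active_gradient_neg:
  fixes x0 :: "'a::euclidean_space"
  assumes "convex (feasible_set m g)" and "x \<in> feasible_set m g"
    and "\<forall>j\<in>{1..m}. g j x0 < 0" and cont: "\<forall>j\<in>{1..m}. isCont (g j) x0"
    and "j \<in> {1..m}" "g j x = 0" "GDERIV (g j) x :> D" "D \<noteq> 0"
  shows "(x0 - x) \<bullet> D < 0"
proof -
  have "eventually (\<lambda>t. \<forall>i\<in>{1..m}. g i (x0 + t *\<^sub>R D) < 0) (at_right 0)"
    using assms(3) cont by (intro eventually_ball_finite ballI eventually_neg_along_line) auto
  moreover have "eventually (\<lambda>t::real. 0 < t) (at_right 0)"
    by (rule eventually_at_right_less)
  ultimately have "eventually (\<lambda>t. 0 < t \<and> (\<forall>i\<in>{1..m}. g i (x0 + t *\<^sub>R D) < 0)) (at_right (0::real))"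
    by eventually_elim auto
  then obtain t :: real where t: "0 < t" "\<forall>i\<in>{1..m}. g i (x0 + t *\<^sub>R D) < 0"
    using eventually_happens'[OF trivial_limit_at_right_real] by blast
  then have "x0 + t *\<^sub>R D \<in> feasible_set m g"
    by (auto simp: feasible_set_def intro: less_imp_le)
  then have "(x0 + t *\<^sub>R D - x) \<bullet> D \<le> 0"
    using active_gradient_nonpos[of m g x _ j D] assms by blast
  then have "(x0 - x) \<bullet> D + t * (D \<bullet> D) \<le> 0"
    by (simp add: algebra_simps)
  moreover have "t * (D \<bullet> D) > 0"
    using t \<open>D \<noteq> 0\<close> by simp
  ultimately show ?thesis by linarith
qed

text \<open>A short step along \<open>u\<close> lowers \<open>f\<close>, so it must leave the
  feasible set. Inactive constraints stay negative by continuity, and active ones with negative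
  slope become negative, so some active constraint has nonnegative slope.\<close>

lemma minimizer_no_descent_direction:
  fixes x :: "'a::euclidean_space"
  assumes "minimizer_on f (feasible_set m g) x"
    and f: "GDERIV f x :> D" and g: "\<forall>j\<in>{1..m}. GDERIV (g j) x :> G j"
    and "u \<bullet> D < 0"
  shows "\<exists>j\<in>{1..m}. g j x = 0 \<and> u \<bullet> G j \<ge> 0"
proof (rule ccontr)
  assume neg: "\<not> ?thesis"
  have "eventually (\<lambda>t. g j (x + t *\<^sub>R u) < 0) (at_right 0)" if j: "j \<in> {1..m}" for j
  proof (cases "g j x = 0")
    case True
    then show ?thesis
      using eventually_less_along_line[of "g j" x "G j" u] neg g j by force
  next
    case False
    then have "g j x < 0"
      using assms(1) j by (force simp: minimizer_on_def feasible_set_def)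
    moreover have "isCont (g j) x"
      using g j has_derivative_continuous unfolding gderiv_def by blast
    ultimately show ?thesis by (intro eventually_neg_along_line)
  qed
  then have "eventually (\<lambda>t. \<forall>j\<in>{1..m}. g j (x + t *\<^sub>R u) < 0) (at_right 0)"
    by (intro eventually_ball_finite) auto
  with eventually_less_along_line[OF f \<open>u \<bullet> D < 0\<close>]
  have "eventually (\<lambda>t. f (x + t *\<^sub>R u) < f x \<and> (\<forall>j\<in>{1..m}. g j (x + t *\<^sub>R u) < 0)) (at_right 0)"
    by (rule eventually_conj)
  then obtain t :: real where
    t: "f (x + t *\<^sub>R u) < f x" "\<forall>j\<in>{1..m}. g j (x + t *\<^sub>R u) < 0"
    using eventually_happens'[OF trivial_limit_at_right_real] by blast
  then have "x + t *\<^sub>R u \<in> feasible_set m g"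
    by (auto simp: feasible_set_def intro: less_imp_le)
  with assms(1) t(1) show False
    by (force simp: minimizer_on_def)
qed

section \<open>Minimizers and KKT points\<close>

text \<open>The last hypothesis is the Mangasarian-Fromovitz constraint qualification at
  \<open>x\<close>, with witness \<open>d\<close>; it turns Fritz John multipliers \<open>c\<close>
  into KKT multipliers \<open>l\<close>.\<close>

lemma minimizer_imp_KKT_point:
  fixes x :: "'a::euclidean_space"
  assumes min: "minimizer_on f (feasible_set m g) x"
    and f: "f differentiable (at x)" and g: "\<forall>j\<in>{1..m}. g j differentiable (at x)"
    and d: "\<forall>j\<in>{1..m}. g j x = 0 \<longrightarrow> d \<bullet> gradient (g j) x < 0"
  shows "KKT_point f m g x"
proof -
  define A where "A = {j\<in>{1..m}. g j x = 0}"
  \<comment> \<open>the index \<open>0\<close>, which names no constraint, stands for the objective\<close>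
  define a where "a = (\<lambda>j. if j = 0 then gradient f x else gradient (g j) x)"
  have A: "finite A" "0 \<notin> A" by (auto simp: A_def)
  have a: "a j = gradient (g j) x" if "j \<in> A" for j
    using that A(2) by (auto simp: a_def)
  have "\<nexists>u. \<forall>j\<in>insert 0 A. u \<bullet> a j < 0"
  proof
    assume "\<exists>u. \<forall>j\<in>insert 0 A. u \<bullet> a j < 0"
    then obtain u where u: "u \<bullet> gradient f x < 0" "\<And>j. j \<in> A \<Longrightarrow> u \<bullet> gradient (g j) x < 0"
      by (metis a a_def insertCI)
    then have "\<exists>j\<in>{1..m}. g j x = 0 \<and> u \<bullet> gradient (g j) x \<ge> 0"
      using f g by (intro minimizer_no_descent_direction[OF min]) (auto intro: GDERIV_gradient)
    with u(2) show False by (force simp: A_def)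
  qed
  with A obtain c where c: "\<forall>j\<in>insert 0 A. 0 \<le> c j" "sum c (insert 0 A) = 1"
      "(\<Sum>j\<in>insert 0 A. c j *\<^sub>R a j) = 0"
    using gordan_alternative[of "insert 0 A" a] by auto
  have sum0: "c 0 *\<^sub>R gradient f x + (\<Sum>j\<in>A. c j *\<^sub>R gradient (g j) x) = 0"
    using c(3) A a by (simp add: a_def cong: sum.cong_simp)
  \<comment> \<open>If \<open>c 0\<close> were 0, the inner product of \<open>sum0\<close> with
    \<open>d\<close> would be a vanishing sum of nonpositive terms. As \<open>d\<close> has strictly
    negative slopes, every \<open>c j\<close> would be 0, against the total being 1.\<close>
  have "c 0 \<noteq> 0"
  proof
    assume "c 0 = 0"
    with sum0 have "(\<Sum>j\<in>A. c j * (d \<bullet> gradient (g j) x)) = 0"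
      by (simp flip: inner_scaleR_right inner_sum_right)
    moreover have "c j * (d \<bullet> gradient (g j) x) \<le> 0" if "j \<in> A" for j
      using that c(1) d by (intro mult_nonneg_nonpos) (auto simp: A_def intro: less_imp_le)
    ultimately have "\<forall>j\<in>A. c j * (d \<bullet> gradient (g j) x) = 0"
      using sum_nonneg_eq_0_iff[OF A(1), of "\<lambda>j. - (c j * (d \<bullet> gradient (g j) x))"]
      by (simp add: sum_negf)
    then have "\<forall>j\<in>A. c j = 0"
      using d by (force simp: A_def)
    with c(2) A \<open>c 0 = 0\<close> show False by simp
  qed
  with c(1) have c0: "c 0 > 0" by (simp add: less_le)
  \<comment> \<open>Division by \<open>c 0\<close> scales the multiplier of the objective to 1; the
    value 0 off \<open>A\<close> yields complementary slackness.\<close>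
  define l where "l = (\<lambda>j. if j \<in> A then c j / c 0 else 0)"
  have "(\<Sum>j\<in>{1..m}. l j *\<^sub>R gradient (g j) x) = (\<Sum>j\<in>A. l j *\<^sub>R gradient (g j) x)"
    by (rule sum.mono_neutral_right) (auto simp: A_def l_def)
  also have "\<dots> = (1 / c 0) *\<^sub>R (\<Sum>j\<in>A. c j *\<^sub>R gradient (g j) x)"
    by (simp add: l_def scaleR_sum_right)
  also have "(\<Sum>j\<in>A. c j *\<^sub>R gradient (g j) x) = - (c 0 *\<^sub>R gradient f x)"
    using sum0 by (simp add: eq_neg_iff_add_eq_0 add.commute)
  finally have "gradient f x + (\<Sum>j\<in>{1..m}. l j *\<^sub>R gradient (g j) x) = 0"
    using c0 by simp
  moreover have "\<forall>j\<in>{1..m}. 0 \<le> l j"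
    using c(1) c0 by (auto simp: l_def)
  moreover have "\<forall>j\<in>{1..m}. l j * g j x = 0"
    by (auto simp: l_def A_def)
  ultimately show ?thesis
    using min by (auto simp: KKT_point_def minimizer_on_def)
qed

text \<open>In the inner product of the stationarity equation with \<open>y - x\<close>, every
  constraint term is nonpositive: by convexity of the feasible set if active, by complementary
  slackness otherwise. Hence \<open>f\<close> has nonnegative slope towards \<open>y\<close>, and
  its gradient inequality concludes.\<close>

lemma KKT_point_imp_minimizer:
  fixes x :: "'a::euclidean_space"
  assumes kkt: "KKT_point f m g x" and "convex (feasible_set m g)" and "convex_on UNIV f"
    and f: "f differentiable (at x)" and g: "\<forall>j\<in>{1..m}. g j differentiable (at x)"
  shows "minimizer_on f (feasible_set m g) x"
proof -
  obtain l where x: "x \<in> feasible_set m g" and l: "\<forall>j\<in>{1..m}. 0 \<le> l j"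
      "gradient f x + (\<Sum>j\<in>{1..m}. l j *\<^sub>R gradient (g j) x) = 0"
      "\<forall>j\<in>{1..m}. l j * g j x = 0"
    using kkt by (auto simp: KKT_point_def)
  have "f x \<le> f y" if y: "y \<in> feasible_set m g" for y
  proof -
    have "l j * ((y - x) \<bullet> gradient (g j) x) \<le> 0" if j: "j \<in> {1..m}" for j
    proof (cases "g j x = 0")
      case True
      then have "(y - x) \<bullet> gradient (g j) x \<le> 0"
        using active_gradient_nonpos[OF assms(2) x y j] g j by (blast intro: GDERIV_gradient)
      then show ?thesis using l(1) j by (simp add: mult_nonneg_nonpos)
    next
      case False
      then have "l j = 0" using l(3) j by force
      then show ?thesis by simp
    qed
    then have "(\<Sum>j\<in>{1..m}. l j * ((y - x) \<bullet> gradient (g j) x)) \<le> 0"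
      by (rule sum_nonpos)
    moreover have "(y - x) \<bullet> gradient f x
        + (\<Sum>j\<in>{1..m}. l j * ((y - x) \<bullet> gradient (g j) x)) = 0"
      using arg_cong[OF l(2), of "\<lambda>v. (y - x) \<bullet> v"]
      by (simp only: inner_add_right inner_sum_right inner_scaleR_right inner_zero_right)
    ultimately show ?thesis
      using convex_on_above_gradient[OF assms(3) GDERIV_gradient[OF f], of y] by linarith
  qed
  with x show ?thesis by (simp add: minimizer_on_def)
qed

theorem theorem2p3:
  fixes f :: "real ^ 'n \<Rightarrow> real"
    and m :: nat
    and g :: "nat \<Rightarrow> real ^ 'n \<Rightarrow> real"
    and K :: "(real ^ 'n) set"
  defines "K \<equiv> feasible_set m g"
  assumes f_diff: "\<forall>x. f differentiable (at x)"
    and g_diff: "\<forall>j\<in>{1..m}. \<forall>x. g j differentiable (at x)"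
    and convex_K: "convex K"
    and nondegenerate: "\<forall>j\<in>{1..m}. \<forall>x\<in>K. g j x = 0 \<longrightarrow> gradient (g j) x \<noteq> 0"
    and slater: "\<exists>x0\<in>K. \<forall>j\<in>{1..m}. g j x0 < 0"
    and convex_f: "convex_on UNIV f"
  shows "(\<forall>x. minimizer_on f K x \<longrightarrow> KKT_point f m g x) \<and>
         (\<forall>x. KKT_point f m g x \<longrightarrow> minimizer_on f K x)"
proof (intro conjI allI impI)
  fix x assume min: "minimizer_on f K x"
  then have x: "x \<in> K" by (simp add: minimizer_on_def)
  obtain x0 where x0: "\<forall>j\<in>{1..m}. g j x0 < 0"
    using slater by blast
  have cont: "\<forall>j\<in>{1..m}. isCont (g j) x0"
    using g_diff by (blast intro: differentiable_imp_continuous_within)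
  \<comment> \<open>The direction to the Slater point serves all active constraints at once, as the
    constraint qualification demands.\<close>
  have "(x0 - x) \<bullet> gradient (g j) x < 0" if "j \<in> {1..m}" "g j x = 0" for j
    using active_gradient_neg[OF convex_K[unfolded K_def] x[unfolded K_def] x0 cont that]
      GDERIV_gradient g_diff nondegenerate x that by blast
  then show "KKT_point f m g x"
    using min f_diff g_diff unfolding K_def
    by (intro minimizer_imp_KKT_point[where d = "x0 - x"]) auto
next
  fix x assume "KKT_point f m g x"
  then show "minimizer_on f K x"
    using KKT_point_imp_minimizer convex_K convex_f f_diff g_diff unfolding K_def by blast
qed

end
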